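(* Let $\overline B=(V,\overline E)$ be a generalized Bratteli diagram of bounded size defined by a sequence $(t_n,L_n)_{n\in\mathbb N_0}$, and let $\overline\mu$ be a probability tail invariant measure on $X_{\overline B}$. Then there exists an edge extension $B$ of $\overline B$, obtained by adding countably many edges to $\overline E_n$ for every level $n\in\mathbb N_0$, such that the measure extension $\widehat{\overline\mu}$ of $\overline\mu$ to $X_B$ is finite.
   Context: A generalized Bratteli diagram is a graded graph $B=(V,E)$, $V=\bigsqcup_{n\ge0}V_n$, $E=\bigsqcup_{n\ge0}E_n$, with each $V_n$ countably infinite and each $E_n$ countable; every $e\in E_n$ has a source $s(e)\in V_n$ and a range $r(e)\in V_{n+1}$; $s^{-1}(v)\ne\emptyset$ for all $v\in V$; $r^{-1}(v)$ is nonempty and finite for all $v\in V\setminus V_0$. The incidence matrix $F_n=(f^{(n)}_{v,w})_{v\in V_{n+1},w\in V_n}$ counts the edges between $w$ and $v$. The diagram is of bounded size with parameters $(t_n,L_n)$ (natural numbers) if $V_n=\mathbb Z$ for all $n$ and for all $n$ and $v\in V_{n+1}$: $s(r^{-1}(v))\subset\{v-t_n,\dots,v+t_n\}$ and $\sum_{w}f^{(n)}_{v,w}\le L_n$. The path space $X_B$ is the set of infinite sequences $(x_n)$, $x_n\in E_n$, $r(x_n)=s(x_{n+1})$, with the topology generated by cylinder sets of finite paths starting in $V_0$. Two paths are tail equivalent (relation $\mathcal R$) if they agree from some index on. A tail invariant measure is a non-atomic positive Borel measure giving equal value to cylinder sets $[\overline e]$, $[\overline e']$ whenever $\overline e,\overline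 e'$ are finite paths from $V_0$ to the same vertex. Edge extension: a generalized Bratteli diagram $B=(V,E)$ with the same vertices, obtained from $\overline B$ by adding edges to every level $\overline E_n$. Measure extension: $\widehat X_{\overline B}\subset X_B$ is the set of all paths of $X_B$ tail equivalent to some path of $X_{\overline B}$; $\widehat{\overline\mu}$ is the unique $\mathcal R$-invariant Borel measure on $\widehat X_{\overline B}$ extending $\overline\mu$ (set to $0$ on $X_B\setminus\widehat X_{\overline B}$): for a finite path $f$ of $B$ from $V_0$ to $v\in V_n$, the set of paths that begin with $f$ and whose edges after $f$ all lie in $\overline B$ has $\widehat{\overline\mu}$-measure equal to the $\overline\mu$-measure of a cylinder set of $X_{\overline B}$ ending at $v$. *)

theory Defs
  imports "HOL-Probability.Probability"
begin

(* A graded graph is given level by level: level n of the vertex set (edge set) of B is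
   verts B n (edges B n), and the disjoint unions over n are kept implicit in the index n.
   So the same element of type 'v may occur at several levels, as distinct vertices. *)
record ('v, 'e) graded_graph =
  verts :: "nat \<Rightarrow> 'v set"
  edges :: "nat \<Rightarrow> 'e set"
  src :: "nat \<Rightarrow> 'e \<Rightarrow> 'v"
  rng :: "nat \<Rightarrow> 'e \<Rightarrow> 'v"

definition edges_into :: "('v, 'e) graded_graph \<Rightarrow> nat \<Rightarrow> 'v \<Rightarrow> 'e set" where
  "edges_into B n v = {e \<in> edges B n. rng B n e = v}"

definition generalized_bratteli_diagram :: "('v, 'e) graded_graph \<Rightarrow> bool" where
  "generalized_bratteli_diagram B \<longleftrightarrow>
     (\<forall>n. countable (verts B n) \<and> infinite (verts B n)) \<and>
     (\<forall>n. countable (edges B n)) \<and>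
     (\<forall>n. \<forall>e \<in> edges B n. src B n e \<in> verts B n \<and> rng B n e \<in> verts B (Suc n)) \<and>
     (\<forall>n. \<forall>v \<in> verts B n. {e \<in> edges B n. src B n e = v} \<noteq> {}) \<and>
     (\<forall>n. \<forall>v \<in> verts B (Suc n). edges_into B n v \<noteq> {} \<and> finite (edges_into B n v))"

definition incidence :: "('v, 'e) graded_graph \<Rightarrow> nat \<Rightarrow> 'v \<Rightarrow> 'v \<Rightarrow> nat" where
  "incidence B n v w = card {e \<in> edges B n. src B n e = w \<and> rng B n e = v}"

(* The row sum runs over the finite window v - t n .. v + t n, outside of which the row vanishes
   by the preceding conjunct; sum over all of int would be 0 by convention. *)
definition bounded_size ::
    "(int, 'e) graded_graph \<Rightarrow> (nat \<Rightarrow> nat) \<Rightarrow> (nat \<Rightarrow> nat) \<Rightarrow> bool" where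
  "bounded_size B t L \<longleftrightarrow>
     generalized_bratteli_diagram B \<and>
     (\<forall>n. verts B n = UNIV) \<and>
     (\<forall>n v. src B n ` edges_into B n v \<subseteq> {v - int (t n)..v + int (t n)} \<and>
            (\<Sum>w = v - int (t n)..v + int (t n). incidence B n v w) \<le> L n)"

definition path_space :: "('v, 'e) graded_graph \<Rightarrow> (nat \<Rightarrow> 'e) set" where
  "path_space B =
     {x. \<forall>n. x n \<in> edges B n \<and> rng B n (x n) = src B (Suc n) (x (Suc n))}"

(* Finite paths start in level 0 and have at least one edge. *)
definition finite_path :: "('v, 'e) graded_graph \<Rightarrow> 'e list \<Rightarrow> bool" where
  "finite_path B p \<longleftrightarrow>
     p \<noteq> [] \<and>
     (\<forall>i < length p. p ! i \<in> edges B i) \<and>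
     (\<forall>i. Suc i < length p \<longrightarrow> rng B i (p ! i) = src B (Suc i) (p ! Suc i))"

(* The level is part of the end vertex, since vertices of different levels are distinct. *)
definition path_end :: "('v, 'e) graded_graph \<Rightarrow> 'e list \<Rightarrow> nat \<times> 'v" where
  "path_end B p = (length p, rng B (length p - 1) (last p))"

definition cylinder :: "('v, 'e) graded_graph \<Rightarrow> 'e list \<Rightarrow> (nat \<Rightarrow> 'e) set" where
  "cylinder B p = {x \<in> path_space B. \<forall>i < length p. x i = p ! i}"

definition path_topology :: "('v, 'e) graded_graph \<Rightarrow> (nat \<Rightarrow> 'e) topology" where
  "path_topology B = topology_generated_by {cylinder B p | p. finite_path B p}"

definition path_borel :: "('v, 'e) graded_graph \<Rightarrow> (nat \<Rightarrow> 'e) measure" where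
  "path_borel B = sigma (path_space B) {U. openin (path_topology B) U}"

definition tail_equivalent :: "(nat \<Rightarrow> 'e) \<Rightarrow> (nat \<Rightarrow> 'e) \<Rightarrow> bool" where
  "tail_equivalent x y \<longleftrightarrow> (\<exists>m. \<forall>n \<ge> m. x n = y n)"

definition measure_atom :: "'a measure \<Rightarrow> 'a set \<Rightarrow> bool" where
  "measure_atom M A \<longleftrightarrow>
     A \<in> sets M \<and> emeasure M A > 0 \<and>
     (\<forall>S \<in> sets M. S \<subseteq> A \<longrightarrow> emeasure M S = 0 \<or> emeasure M (A - S) = 0)"

definition non_atomic :: "'a measure \<Rightarrow> bool" where
  "non_atomic M \<longleftrightarrow> (\<nexists>A. measure_atom M A)"

definition tail_invariant_measure ::
    "('v, 'e) graded_graph \<Rightarrow> (nat \<Rightarrow> 'e) measure \<Rightarrow> bool" where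
  "tail_invariant_measure B M \<longleftrightarrow>
     space M = path_space B \<and>
     sets M = sets (path_borel B) \<and>
     non_atomic M \<and>
     (\<forall>p q. finite_path B p \<and> finite_path B q \<and> path_end B p = path_end B q \<longrightarrow>
        emeasure M (cylinder B p) = emeasure M (cylinder B q))"

(* Adding edges is a tagged disjoint union: the edges Inl e of B are the edges e of C,
   and the edges Inr a are the added ones. *)
definition added_edges :: "('v, 'e + 'f) graded_graph \<Rightarrow> nat \<Rightarrow> 'f set" where
  "added_edges B n = {a. Inr a \<in> edges B n}"

definition edge_extension ::
    "('v, 'e) graded_graph \<Rightarrow> ('v, 'e + 'f) graded_graph \<Rightarrow> bool" where
  "edge_extension C B \<longleftrightarrow>
     generalized_bratteli_diagram C \<and>
     generalized_bratteli_diagram B \<and>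
     (\<forall>n. verts B n = verts C n) \<and>
     (\<forall>n. {e. Inl e \<in> edges B n} = edges C n) \<and>
     (\<forall>n. \<forall>e \<in> edges C n. src B n (Inl e) = src C n e \<and> rng B n (Inl e) = rng C n e) \<and>
     (\<forall>n. added_edges B n \<noteq> {})"

definition embed_path :: "(nat \<Rightarrow> 'e) \<Rightarrow> (nat \<Rightarrow> 'e + 'f)" where
  "embed_path x = (\<lambda>n. Inl (x n))"

definition saturation ::
    "('v, 'e) graded_graph \<Rightarrow> ('v, 'e + 'f) graded_graph \<Rightarrow> (nat \<Rightarrow> 'e + 'f) set" where
  "saturation C B =
     {x \<in> path_space B. \<exists>y \<in> path_space C. tail_equivalent x (embed_path y)}"

(* Among Borel measures, the last two conjuncts determine N: the saturation is the countable
   union, over all p, of the sets in the last one, which have finite measure if M is finite. *)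
definition measure_extension ::
    "('v, 'e) graded_graph \<Rightarrow> (nat \<Rightarrow> 'e) measure \<Rightarrow>
     ('v, 'e + 'f) graded_graph \<Rightarrow> (nat \<Rightarrow> 'e + 'f) measure \<Rightarrow> bool" where
  "measure_extension C M B N \<longleftrightarrow>
     tail_invariant_measure B N \<and>
     (\<forall>A \<in> sets M. embed_path ` A \<in> sets N \<and> emeasure N (embed_path ` A) = emeasure M A) \<and>
     saturation C B \<in> sets N \<and>
     emeasure N (path_space B - saturation C B) = 0 \<and>
     (\<forall>p q. finite_path B p \<and> finite_path C q \<and> path_end B p = path_end C q \<longrightarrow>
        emeasure N {x \<in> cylinder B p. \<forall>k \<ge> length p. x k \<in> Inl ` edges C k}
          = emeasure M (cylinder C q))"

end

(* The extra edges start at the vertex 0 and end far out. Among the cylinders ending at level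
   n + 1, those ending beyond K n carry arbitrarily small total mass if K n is large, whereas
   bounded size caps the number of paths of the extension ending at 0 in level n by a constant
   independent of K. So the mass picked up through the edges added at level n can be made at most
   2^-n. The extended measure is the sum, over all finite paths r that are empty or end in an
   added edge, of the copy of the original measure on the paths that follow r and then use
   original edges only. *)
theory Submission
  imports Defs
begin

text \<open>The tail cylinder of a walk of the extension weighs as much as a cylinder of
  \<open>C\<close> with the same end vertex. So the edges added at level n contribute at most the
  number of walks of \<open>B\<close> of length n to their source times the sum, over their targets,
  of one cylinder mass each. The targets cause no trouble: cylinders of walks of equal length with
  distinct ends are disjoint, so the masses are summable and a tail of the series is small. The
  obstacle is the first factor, since it counts walks through edges added at earlier levels and
  might grow with the earlier choices of \<open>K\<close>. It does not, because every vertex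
  receives at most one added edge per level: in-degrees at level i are at most
  \<open>L i + 1\<close> wherever the edges land. So the factor \<open>H n\<close>, the product of
  these bounds over i < n, is fixed first, and \<open>K n\<close> is then chosen with tail sum at
  most 2^-n / \<open>H n\<close>.\<close>

section \<open>Walks, their end vertices and their cylinders\<close>

definition walk :: "('v, 'e) graded_graph \<Rightarrow> 'e list \<Rightarrow> bool" where
  "walk B p \<longleftrightarrow>
     (\<forall>i < length p. p ! i \<in> edges B i) \<and>
     (\<forall>i. Suc i < length p \<longrightarrow> rng B i (p ! i) = src B (Suc i) (p ! Suc i))"

text \<open>Unlike \<open>finite_path\<close>, \<open>walk\<close> admits the empty list, whose
  cylinder is the whole path space. Thus the original paths, followed from level 0 on, are the case
  of an empty prefix. An empty walk records no vertex, so only lengths are compared there.\<close>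

definition same_end ::
    "('v, 'e) graded_graph \<Rightarrow> 'e list \<Rightarrow> ('v, 'f) graded_graph \<Rightarrow> 'f list \<Rightarrow> bool" where
  "same_end B p C q \<longleftrightarrow>
     length p = length q \<and>
     (p \<noteq> [] \<longrightarrow> rng B (length p - 1) (last p) = rng C (length q - 1) (last q))"

definition graft :: "'e list \<Rightarrow> (nat \<Rightarrow> 'e) \<Rightarrow> nat \<Rightarrow> 'e" where
  "graft p x = (\<lambda>k. if k < length p then p ! k else x k)"

lemma finite_path_iff_walk: "finite_path B p \<longleftrightarrow> p \<noteq> [] \<and> walk B p"
  by (simp add: finite_path_def walk_def)

lemma same_end_iff_path_end:
  assumes "p \<noteq> []"
  shows "same_end B p C q \<longleftrightarrow> path_end B p = path_end C q"
  using assms by (auto simp: same_end_def path_end_def)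

lemma same_end_sym: "same_end B p C q \<Longrightarrow> same_end C q B p"
  by (auto simp: same_end_def)

lemma same_end_trans: "same_end B p C q \<Longrightarrow> same_end C q D r \<Longrightarrow> same_end B p D r"
  by (auto simp: same_end_def)

lemma same_end_Nil: "same_end B [] C []"
  by (simp add: same_end_def)

lemma walk_Nil: "walk B []"
  by (simp add: walk_def)

lemma walk_append:
  "walk B (p @ q) \<longleftrightarrow>
     walk B p \<and> (\<forall>i < length q. q ! i \<in> edges B (length p + i)) \<and>
     (\<forall>i. Suc i < length q \<longrightarrow>
        rng B (length p + i) (q ! i) = src B (Suc (length p + i)) (q ! Suc i)) \<and>
     (p \<noteq> [] \<and> q \<noteq> [] \<longrightarrow>
        rng B (length p - 1) (last p) = src B (length p) (hd q))" (is "?L \<longleftrightarrow> ?R")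
proof
  assume L: ?L
  have e: "(p @ q) ! i \<in> edges B i" if "i < length p + length q" for i
    using L that by (simp add: walk_def)
  have s: "rng B i ((p @ q) ! i) = src B (Suc i) ((p @ q) ! Suc i)"
    if "Suc i < length p + length q" for i
    using L that by (simp add: walk_def)
  have "walk B p"
    unfolding walk_def
  proof (intro conjI allI impI)
    fix i assume "i < length p"
    then show "p ! i \<in> edges B i" using e[of i] by (simp add: nth_append)
  next
    fix i assume "Suc i < length p"
    then show "rng B i (p ! i) = src B (Suc i) (p ! Suc i)"
      using s[of i] by (simp add: nth_append)
  qed
  moreover have "q ! i \<in> edges B (length p + i)" if "i < length q" for i
    using e[of "length p + i"] that by (simp add: nth_append)
  moreover have "rng B (length p + i) (q ! i) = src B (Suc (length p + i)) (q ! Suc i)"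
    if "Suc i < length q" for i
    using s[of "length p + i"] that by (simp add: nth_append)
  moreover have "rng B (length p - 1) (last p) = src B (length p) (hd q)"
    if "p \<noteq> []" "q \<noteq> []"
    using s[of "length p - 1"] that
    by (simp add: nth_append last_conv_nth hd_conv_nth)
  ultimately show ?R by blast
next
  assume R: ?R
  show ?L
    unfolding walk_def
  proof (intro conjI allI impI)
    fix i assume i: "i < length (p @ q)"
    show "(p @ q) ! i \<in> edges B i"
    proof (cases "i < length p")
      case True
      then show ?thesis using R by (simp add: nth_append walk_def)
    next
      case False
      then obtain j where "i = length p + j" by (metis le_add_diff_inverse not_less)
      then show ?thesis using R i by simp
    qed
  next
    fix i assume i: "Suc i < length (p @ q)"
    consider "Suc i < length p" | "Suc i = length p" | "length p \<le> i" by linarith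
    then show "rng B i ((p @ q) ! i) = src B (Suc i) ((p @ q) ! Suc i)"
    proof cases
      case 1
      then show ?thesis using R by (simp add: nth_append walk_def)
    next
      case 2
      then have "p \<noteq> []" "q \<noteq> []" using i by auto
      moreover have "i = length p - 1" using 2 by simp
      ultimately show ?thesis
        using R 2 by (simp add: nth_append last_conv_nth hd_conv_nth)
    next
      case 3
      define j where "j = i - length p"
      have ij: "i = length p + j" using 3 by (simp add: j_def)
      then have "Suc j < length q" using i by simp
      then show ?thesis using R ij by (simp add: nth_append)
    qed
  qed
qed

lemma walk_snoc:
  "walk B (p @ [e]) \<longleftrightarrow>
     walk B p \<and> e \<in> edges B (length p) \<and>
     (p \<noteq> [] \<longrightarrow> rng B (length p - 1) (last p) = src B (length p) e)"
  by (auto simp: walk_append)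

text \<open>The continuations of a walk depend only on where it ends; tail invariance of the
  extended measure rests on this.\<close>

lemma walk_append_same_end:
  assumes "walk B p" "walk B q" "same_end B p B q"
  shows "walk B (p @ u) \<longleftrightarrow> walk B (q @ u)"
proof -
  have "length p = length q" "p = [] \<longleftrightarrow> q = []" using assms(3) by (auto simp: same_end_def)
  then show ?thesis using assms by (auto simp: walk_append same_end_def)
qed

lemma same_end_append:
  assumes "same_end B p B q"
  shows "same_end B (p @ u) B (q @ u)"
  using assms by (cases u rule: rev_cases) (auto simp: same_end_def)

lemma walk_of_path: "x \<in> path_space B \<Longrightarrow> walk B (map x [0..<n])"
  by (auto simp: walk_def path_space_def)

lemma mem_cylinder_map: "x \<in> path_space B \<Longrightarrow> x \<in> cylinder B (map x [0..<n])"
  by (simp add: cylinder_def)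

lemma mem_cylinder_iff:
  "x \<in> cylinder B p \<longleftrightarrow> x \<in> path_space B \<and> map x [0..<length p] = p"
proof -
  have "map x [0..<length p] = p \<longleftrightarrow> map x [0..<length p] = map ((!) p) [0..<length p]"
    by (simp only: map_nth)
  then show ?thesis by (auto simp: cylinder_def)
qed

lemma cylinder_Nil: "cylinder B [] = path_space B"
  by (simp add: cylinder_def)

lemma cylinder_subset_path_space: "cylinder B p \<subseteq> path_space B"
  by (auto simp: cylinder_def)

lemma graft_Nil: "graft [] x = x"
  by (simp add: graft_def)

text \<open>Built backwards from \<open>v\<close>, as every vertex above level 0 receives an
  edge.\<close>

lemma ex_walk_to:
  assumes "generalized_bratteli_diagram B" "v \<in> verts B (Suc n)"
  shows "\<exists>p. walk B p \<and> length p = Suc n \<and> rng B n (last p) = v"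
  using assms(2)
proof (induction n arbitrary: v)
  case 0
  then obtain e where "e \<in> edges B 0" "rng B 0 e = v"
    using assms(1) unfolding generalized_bratteli_diagram_def edges_into_def by blast
  then show ?case by (intro exI[of _ "[e]"]) (simp add: walk_def)
next
  case (Suc n)
  then obtain e where e: "e \<in> edges B (Suc n)" "rng B (Suc n) e = v"
    using assms(1) unfolding generalized_bratteli_diagram_def edges_into_def by blast
  then have "src B (Suc n) e \<in> verts B (Suc n)"
    using assms(1) unfolding generalized_bratteli_diagram_def by blast
  from Suc.IH[OF this] obtain p where
    "walk B p" "length p = Suc n" "rng B n (last p) = src B (Suc n) e"
    by blast
  then show ?case using e by (intro exI[of _ "p @ [e]"]) (simp add: walk_snoc)
qed

subsection \<open>The Borel structure of the path space\<close>

lemma countable_walks: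
  assumes "generalized_bratteli_diagram B"
  shows "countable {p. walk B p}"
proof (rule countable_subset)
  show "{p. walk B p} \<subseteq> lists (\<Union>n. edges B n)"
    by (auto simp: walk_def in_lists_conv_set in_set_conv_nth) blast
  show "countable (lists (\<Union>n. edges B n))"
    using assms by (auto simp: generalized_bratteli_diagram_def)
qed

text \<open>The generating cylinders are a base and not just a subbase: of two cylinders through a
  common path, the one with the longer prefix lies in the other.\<close>

lemma openin_path_topology_cylinder:
  assumes "openin (path_topology B) U" "x \<in> U"
  shows "\<exists>p. finite_path B p \<and> x \<in> cylinder B p \<and> cylinder B p \<subseteq> U"
proof -
  have "generate_topology_on {cylinder B p | p. finite_path B p} U"
    using assms(1) by (simp add: path_topology_def openin_topology_generated_by_iff)
  then show ?thesis using assms(2)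
  proof (induction rule: generate_topology_on.induct)
    case (Int U V)
    then obtain p q where p: "finite_path B p" "x \<in> cylinder B p" "cylinder B p \<subseteq> U"
      and q: "finite_path B q" "x \<in> cylinder B q" "cylinder B q \<subseteq> V"
      by blast
    have nested: "cylinder B s \<subseteq> cylinder B r"
      if "x \<in> cylinder B r" "x \<in> cylinder B s" "length r \<le> length s" for r s
      using that by (fastforce simp: cylinder_def)
    show ?case
    proof (cases "length p \<le> length q")
      case True
      then show ?thesis using p q nested[of p q] by blast
    next
      case False
      then show ?thesis using p q nested[of q p] by (meson Int_greatest linear order_trans)
    qed
  next
    case (UN K)
    then obtain V where V: "V \<in> K" "x \<in> V" by blast
    from UN.IH[OF this] show ?case using V(1) by blast
  qed auto
qed

lemma openin_cylinder: "finite_path B p \<Longrightarrow> openin (path_topology B) (cylinder B p)"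
  by (auto simp: path_topology_def intro!: topology_generated_by_Basis)

lemma openin_path_topology_subset:
  "openin (path_topology B) U \<Longrightarrow> U \<subseteq> path_space B"
  using openin_path_topology_cylinder cylinder_subset_path_space by fast

lemma space_path_borel: "space (path_borel B) = path_space B"
  by (simp add: path_borel_def space_measure_of_conv)

lemma sets_path_borel_open:
  "openin (path_topology B) U \<Longrightarrow> U \<in> sets (path_borel B)"
  unfolding path_borel_def
  by (rule in_measure_of) (use openin_path_topology_subset in auto)

lemma sets_cylinder:
  assumes "walk B p"
  shows "cylinder B p \<in> sets (path_borel B)"
proof (cases "p = []")
  case True
  then show ?thesis using sets.top[of "path_borel B"] by (simp add: cylinder_Nil space_path_borel)
next
  case False
  then show ?thesis
    using assms by (simp add: sets_path_borel_open openin_cylinder finite_path_iff_walk)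
qed

text \<open>\<open>Q\<close> may be arbitrary because there are only countably many walks of length
  \<open>Suc n\<close>.\<close>

lemma sets_path_coordinate:
  assumes "generalized_bratteli_diagram B"
  shows "{x \<in> path_space B. Q (x n)} \<in> sets (path_borel B)"
proof -
  let ?P = "{p. walk B p \<and> length p = Suc n \<and> Q (p ! n)}"
  have "{x \<in> path_space B. Q (x n)} = (\<Union>p\<in>?P. cylinder B p)"
  proof (intro equalityI subsetI)
    fix x assume x: "x \<in> {x \<in> path_space B. Q (x n)}"
    then have "x \<in> cylinder B (map x [0..<Suc n])" by (blast intro: mem_cylinder_map)
    moreover have "map x [0..<Suc n] \<in> ?P"
      using x walk_of_path[of x B "Suc n"] by (simp add: nth_append)
    ultimately show "x \<in> (\<Union>p\<in>?P. cylinder B p)" by blast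
  qed (auto simp: cylinder_def)
  moreover have "countable ?P"
    by (rule countable_subset[OF _ countable_walks[OF assms]]) auto
  ultimately show ?thesis
    using sets_cylinder by (auto intro!: sets.countable_UN')
qed

text \<open>An open set is a countable union of cylinders, and a cylinder a finite intersection of
  conditions on single coordinates.\<close>

lemma measurable_path_borelI:
  assumes B: "generalized_bratteli_diagram B"
    and f: "f \<in> space N \<rightarrow> path_space B"
    and coord: "\<And>n e. e \<in> edges B n \<Longrightarrow> {\<omega> \<in> space N. f \<omega> n = e} \<in> sets N"
  shows "f \<in> measurable N (path_borel B)"
  unfolding path_borel_def
proof (rule measurable_measure_of)
  show "{U. openin (path_topology B) U} \<subseteq> Pow (path_space B)"
    using openin_path_topology_subset by blast
  show "f \<in> space N \<rightarrow> path_space B" by (fact f)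
  fix U assume "U \<in> {U. openin (path_topology B) U}"
  then have U: "openin (path_topology B) U" by simp
  have cyl: "f -` cylinder B p \<inter> space N \<in> sets N" if "finite_path B p" for p
  proof -
    have "f -` cylinder B p \<inter> space N
        = (\<Inter>i\<in>{..<length p}. {\<omega> \<in> space N. f \<omega> i = p ! i})"
      using f that by (auto simp: cylinder_def finite_path_def)
    also have "\<dots> \<in> sets N"
      using that by (intro sets.finite_INT coord) (auto simp: finite_path_def)
    finally show ?thesis .
  qed
  let ?P = "{p. finite_path B p \<and> cylinder B p \<subseteq> U}"
  have "U = (\<Union>p\<in>?P. cylinder B p)"
    using openin_path_topology_cylinder[OF U] by blast
  then have "f -` U \<inter> space N = (\<Union>p\<in>?P. f -` cylinder B p \<inter> space N)"
    by blast
  also have "countable ?P"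
    by (rule countable_subset[OF _ countable_walks[OF B]]) (auto simp: finite_path_iff_walk)
  then have "(\<Union>p\<in>?P. f -` cylinder B p \<inter> space N) \<in> sets N"
    by (rule sets.countable_UN') (use cyl in blast)
  finally show "f -` U \<inter> space N \<in> sets N" .
qed

subsection \<open>The extended measure\<close>

text \<open>The extended measure is constructed for an arbitrary edge extension; its total mass is
  estimated only for the specific one below.\<close>

locale bratteli_measure_extension =
  fixes C :: "('v, 'e) graded_graph"
    and B :: "('v, 'e + 'f) graded_graph"
    and M :: "(nat \<Rightarrow> 'e) measure"
  assumes edge_ext: "edge_extension C B"
    and invariant: "tail_invariant_measure C M"
begin

lemma diagram_C: "generalized_bratteli_diagram C"
  and diagram_B: "generalized_bratteli_diagram B"
  and verts_eq: "verts B n = verts C n"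
  and Inl_edge_iff: "Inl e \<in> edges B n \<longleftrightarrow> e \<in> edges C n"
  and src_Inl: "e \<in> edges C n \<Longrightarrow> src B n (Inl e) = src C n e"
  and rng_Inl: "e \<in> edges C n \<Longrightarrow> rng B n (Inl e) = rng C n e"
  using edge_ext unfolding edge_extension_def by auto

lemma space_M: "space M = path_space C"
  and sets_M: "sets M = sets (path_borel C)"
  and non_atomic_M: "non_atomic M"
  using invariant unfolding tail_invariant_measure_def by auto

lemma emeasure_cylinder_same_end:
  assumes "walk C p" "walk C q" "same_end C p C q"
  shows "emeasure M (cylinder C p) = emeasure M (cylinder C q)"
proof (cases "p = []")
  case True
  then show ?thesis using assms by (auto simp: same_end_def)
next
  case False
  then have "q \<noteq> []" using assms(3) by (auto simp: same_end_def)
  with False have "finite_path C p" "finite_path C q" "path_end C p = path_end C q"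
    using assms by (simp_all add: finite_path_iff_walk flip: same_end_iff_path_end)
  then show ?thesis using invariant unfolding tail_invariant_measure_def by blast
qed

lemma ex_same_end:
  assumes "walk B r"
  shows "\<exists>q. walk C q \<and> same_end B r C q"
proof (cases r rule: rev_cases)
  case Nil
  then show ?thesis using walk_Nil same_end_Nil by blast
next
  case (snoc r' e)
  then have "e \<in> edges B (length r')" using assms by (simp add: walk_snoc)
  then have "rng B (length r') e \<in> verts C (Suc (length r'))"
    using diagram_B verts_eq unfolding generalized_bratteli_diagram_def by blast
  from ex_walk_to[OF diagram_C this] show ?thesis
    using snoc by (auto simp: same_end_def)
qed

section \<open>Transport of cylinders between the two path spaces\<close>

text \<open>The tail of a path of \<open>B\<close> after \<open>r\<close> can use original edges
  only, but to be measured by \<open>M\<close> it needs an initial segment in \<open>C\<close> as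
  well. Any walk of \<open>C\<close> to the end of \<open>r\<close> serves: by tail invariance the
  mass of its cylinder does not depend on the choice.\<close>

definition companion :: "('e + 'f) list \<Rightarrow> 'e list" where
  "companion r = (SOME q. walk C q \<and> same_end B r C q)"

lemma companion:
  assumes "walk B r"
  shows walk_companion: "walk C (companion r)"
    and same_end_companion: "same_end B r C (companion r)"
  using someI_ex[OF ex_same_end[OF assms]] by (auto simp: companion_def)

lemma companion_Nil: "companion [] = []"
  using same_end_companion[OF walk_Nil] by (simp add: same_end_def)

text \<open>These are the sets on which \<open>measure_extension\<close> prescribes the mass; for
  \<open>p = []\<close> it is the embedded path space of \<open>C\<close>.\<close>

definition tail_cylinder :: "('e + 'f) list \<Rightarrow> (nat \<Rightarrow> 'e + 'f) set" where
  "tail_cylinder p = {x \<in> cylinder B p. \<forall>k \<ge> length p. x k \<in> Inl ` edges C k}"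

lemma tail_cylinder_subset_path_space: "tail_cylinder p \<subseteq> path_space B"
  by (auto simp: tail_cylinder_def cylinder_def)

text \<open>Each path of the saturation leaves the added edges for good after exactly one such
  \<open>r\<close>, its prefix up to and including the last added edge.\<close>

definition exits :: "('e + 'f) list set" where
  "exits = {r. walk B r \<and> (r \<noteq> [] \<longrightarrow> last r \<in> range Inr)}"

abbreviation transfer :: "('e + 'f) list \<Rightarrow> (nat \<Rightarrow> 'e) \<Rightarrow> nat \<Rightarrow> 'e + 'f" where
  "transfer r y \<equiv> graft r (embed_path y)"

text \<open>Only the junction between \<open>r\<close> and the rest of \<open>y\<close> matters:
  there \<open>y\<close> comes from the end of \<open>q\<close>, which is also the end of
  \<open>r\<close>.\<close>

lemma transfer_mem_tail_cylinder:
  assumes r: "walk B r" and q: "same_end B r C q" and y: "y \<in> cylinder C q"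
  shows "transfer r y \<in> tail_cylinder r"
proof -
  have yE: "y n \<in> edges C n" and yS: "rng C n (y n) = src C (Suc n) (y (Suc n))" for n
    using y by (auto simp: cylinder_def path_space_def)
  have len: "length q = length r" using q by (simp add: same_end_def)
  have "transfer r y \<in> path_space B"
    unfolding path_space_def
  proof (intro CollectI allI conjI)
    fix n
    show "transfer r y n \<in> edges B n"
      using r yE by (simp add: graft_def embed_path_def walk_def Inl_edge_iff)
    consider "Suc n < length r" | "Suc n = length r" | "length r \<le> n" by linarith
    then show "rng B n (transfer r y n) = src B (Suc n) (transfer r y (Suc n))"
    proof cases
      case 1
      then show ?thesis using r by (simp add: graft_def walk_def)
    next
      case 2
      have ne: "r \<noteq> []" "q \<noteq> []" using 2 len by auto
      have n: "n = length r - 1" using 2 by simp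
      have "rng B n (r ! n) = rng C n (q ! n)"
        using q ne n len by (simp add: same_end_def last_conv_nth)
      also have "q ! n = y n" using y 2 len by (simp add: cylinder_def)
      finally show ?thesis
        using 2 yS yE by (simp add: graft_def embed_path_def src_Inl)
    next
      case 3
      then show ?thesis using yS yE by (simp add: graft_def embed_path_def src_Inl rng_Inl)
    qed
  qed
  then show ?thesis
    using yE by (auto simp: tail_cylinder_def cylinder_def graft_def embed_path_def)
qed

text \<open>The inverse of \<open>transfer r\<close>: it puts back the prefix \<open>q\<close> that
  the transfer has overwritten and strips the tags from the tail.\<close>

lemma untransfer:
  assumes q: "walk C q" "same_end B r C q" and x: "x \<in> tail_cylinder r"
  shows untransfer_mem: "graft q (\<lambda>k. projl (x k)) \<in> cylinder C q"
    and transfer_untransfer: "transfer r (graft q (\<lambda>k. projl (x k))) = x"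
proof -
  let ?y = "graft q (\<lambda>k. projl (x k))"
  have len: "length q = length r" using q by (simp add: same_end_def)
  have tail: "Inl (projl (x k)) = x k" "projl (x k) \<in> edges C k" if "length r \<le> k" for k
    using x that by (fastforce simp: tail_cylinder_def)+
  have xS: "rng B n (x n) = src B (Suc n) (x (Suc n))" for n
    using x by (auto simp: tail_cylinder_def cylinder_def path_space_def)
  have xr: "x i = r ! i" if "i < length r" for i
    using x that by (auto simp: tail_cylinder_def cylinder_def)
  have "?y \<in> path_space C"
    unfolding path_space_def
  proof (intro CollectI allI conjI)
    fix n
    show "?y n \<in> edges C n"
      using q(1) tail len by (simp add: graft_def walk_def)
    consider "Suc n < length r" | "Suc n = length r" | "length r \<le> n" by linarith
    then show "rng C n (?y n) = src C (Suc n) (?y (Suc n))"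
    proof cases
      case 1
      then show ?thesis using q len by (simp add: graft_def walk_def)
    next
      case 2
      have ne: "r \<noteq> []" "q \<noteq> []" using 2 len by auto
      have n: "n = length r - 1" using 2 by simp
      have "rng C n (q ! n) = rng B n (r ! n)"
        using q ne n len by (simp add: same_end_def last_conv_nth)
      also have "r ! n = x n" using xr 2 by simp
      also have "rng B n (x n) = src C (Suc n) (projl (x (Suc n)))"
        using xS[of n] tail[of "Suc n"] src_Inl[of "projl (x (Suc n))" "Suc n"] 2 by simp
      finally show ?thesis
        using 2 len by (simp add: graft_def)
    next
      case 3
      then show ?thesis
        using xS[of n] tail[of n] tail[of "Suc n"] src_Inl[of "projl (x (Suc n))" "Suc n"]
          rng_Inl[of "projl (x n)" n] len
        by (simp add: graft_def)
    qed
  qed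
  then show "?y \<in> cylinder C q" by (auto simp: cylinder_def graft_def)
  show "transfer r ?y = x"
    using xr tail(1) len by (auto simp: graft_def embed_path_def)
qed

text \<open>The transfer forgets only the prefix, and all paths of the cylinder share it.\<close>

lemma inj_on_transfer:
  assumes "length q = length r"
  shows "inj_on (transfer r) (cylinder C q)"
proof (rule inj_onI, rule ext)
  fix y y' k
  assume y: "y \<in> cylinder C q" "y' \<in> cylinder C q" and eq: "transfer r y = transfer r y'"
  show "y k = y' k"
  proof (cases "k < length r")
    case True
    then show ?thesis using y assms by (simp add: cylinder_def)
  next
    case False
    then show ?thesis using fun_cong[OF eq, of k] by (simp add: graft_def embed_path_def)
  qed
qed

section \<open>Decomposition of the saturation by the last added edge\<close>

text \<open>If one of \<open>u\<close>, \<open>v\<close> were longer, its last edge would be an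
  added one at an index where the other tail cylinder allows original edges only. With equal
  lengths, both \<open>p @ u\<close> and \<open>p @ v\<close> are the prefix of \<open>x\<close> of
  that length.\<close>

lemma tail_cylinder_disjoint:
  assumes u: "u \<noteq> [] \<longrightarrow> last u \<in> range Inr" and v: "v \<noteq> [] \<longrightarrow> last v \<in> range Inr"
    and x: "x \<in> tail_cylinder (p @ u)" "x \<in> tail_cylinder (p @ v)"
  shows "u = v"
proof -
  have shorter: "length b \<le> length a"
    if b: "b \<noteq> [] \<longrightarrow> last b \<in> range Inr"
      and xa: "x \<in> tail_cylinder (p @ a)" and xb: "x \<in> tail_cylinder (p @ b)" for a b
  proof (rule ccontr)
    assume "\<not> length b \<le> length a"
    then have lt: "length a < length b" by simp
    then have ne: "b \<noteq> []" by auto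
    let ?k = "length p + (length b - 1)"
    have "x ?k = (p @ b) ! ?k"
      using xb ne by (simp add: tail_cylinder_def cylinder_def)
    also have "\<dots> = last b" using ne by (simp add: nth_append last_conv_nth)
    finally have "x ?k \<in> range Inr" using b ne by simp
    moreover have "x ?k \<in> Inl ` edges C ?k"
      using xa lt by (simp add: tail_cylinder_def)
    ultimately show False by auto
  qed
  have "length u = length v"
    using shorter[OF u x(2,1)] shorter[OF v x] by simp
  moreover have "map x [0..<length (p @ u)] = p @ u" "map x [0..<length (p @ v)] = p @ v"
    using x by (auto simp: tail_cylinder_def mem_cylinder_iff simp del: length_append)
  ultimately show ?thesis by (metis length_append same_append_eq)
qed

lemma split_last_Inr:
  obtains u s where "(w :: ('e + 'f) list) = u @ map Inl s" "u \<noteq> [] \<longrightarrow> last u \<in> range Inr"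
proof (induction w arbitrary: thesis rule: rev_induct)
  case Nil
  then show ?case by (metis append_Nil list.simps(8))
next
  case (snoc a w)
  from snoc.IH obtain u s where us: "w = u @ map Inl s" "u \<noteq> [] \<longrightarrow> last u \<in> range Inr"
    by blast
  show ?case
  proof (cases a)
    case (Inl e)
    then show ?thesis using us snoc.prems[of u "s @ [e]"] by simp
  next
    case (Inr b)
    then show ?thesis using snoc.prems[of "w @ [a]" "[]"] by simp
  qed
qed

text \<open>A tail of original edges always belongs to a path of \<open>C\<close>, since the vertex
  where it starts is also reached by a walk of \<open>C\<close>, the companion.\<close>

lemma saturation_eq:
  "saturation C B = {x \<in> path_space B. \<exists>m. \<forall>k\<ge>m. x k \<in> Inl ` edges C k}"
proof (intro equalityI subsetI)
  fix x assume "x \<in> saturation C B"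
  then obtain y m where "x \<in> path_space B" "y \<in> path_space C" "\<forall>k\<ge>m. x k = Inl (y k)"
    by (auto simp: saturation_def tail_equivalent_def embed_path_def)
  moreover from this have "\<forall>k\<ge>m. x k \<in> Inl ` edges C k"
    by (simp add: path_space_def)
  ultimately show "x \<in> {x \<in> path_space B. \<exists>m. \<forall>k\<ge>m. x k \<in> Inl ` edges C k}"
    by blast
next
  fix x assume "x \<in> {x \<in> path_space B. \<exists>m. \<forall>k\<ge>m. x k \<in> Inl ` edges C k}"
  then obtain m where x: "x \<in> path_space B" and m: "\<forall>k\<ge>m. x k \<in> Inl ` edges C k"
    by blast
  define r where "r = map x [0..<m]"
  have r: "walk B r" "x \<in> tail_cylinder r"
    using x m walk_of_path mem_cylinder_map by (auto simp: r_def tail_cylinder_def)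
  define y where "y = graft (companion r) (\<lambda>k. projl (x k))"
  have "y \<in> path_space C"
    using untransfer_mem[OF companion[OF r(1)] r(2)] cylinder_subset_path_space
    by (auto simp: y_def)
  moreover have "transfer r y = x"
    using transfer_untransfer[OF companion[OF r(1)] r(2)] by (simp add: y_def)
  then have "tail_equivalent x (embed_path y)"
    unfolding tail_equivalent_def by (intro exI[of _ "length r"]) (auto simp: graft_def)
  ultimately show "x \<in> saturation C B" using x by (auto simp: saturation_def)
qed

lemma tail_cylinder_subset_saturation: "tail_cylinder r \<subseteq> saturation C B"
  by (auto simp: tail_cylinder_def saturation_eq cylinder_def)

text \<open>Here \<open>u\<close> is the stretch from the end of \<open>p\<close> to the last added
  edge after \<open>p\<close>, empty if there is none. The last edge of \<open>p\<close> itself may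
  be of either kind.\<close>

lemma cylinder_Int_saturation:
  assumes p: "walk B p"
  shows "cylinder B p \<inter> saturation C B =
    (\<Union>u\<in>{u. walk B (p @ u) \<and> (u \<noteq> [] \<longrightarrow> last u \<in> range Inr)}. tail_cylinder (p @ u))"
    (is "_ = (\<Union>u\<in>?U. _)")
proof (intro equalityI subsetI)
  fix x assume "x \<in> cylinder B p \<inter> saturation C B"
  then obtain m where x: "x \<in> path_space B" "x \<in> cylinder B p"
    and m: "\<forall>k\<ge>m. x k \<in> Inl ` edges C k"
    by (auto simp: saturation_eq)
  \<comment> \<open>From index \<open>l\<close> on all edges are original, and the prefix of length
    \<open>l\<close> contains \<open>p\<close>. So the last added edge after \<open>p\<close>, if
    any, lies in \<open>w\<close>.\<close>
  define l where "l = length p + m"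
  define w where "w = map x [length p..<l]"
  have pw: "map x [0..<l] = p @ w"
    using x upt_add_eq_append[of 0 "length p" m]
    by (simp add: w_def l_def mem_cylinder_iff)
  obtain u s where us: "w = u @ map Inl s" "u \<noteq> [] \<longrightarrow> last u \<in> range Inr"
    using split_last_Inr by blast
  have nth: "x i = (p @ u @ map Inl s) ! i" if "i < l" for i
    using pw us(1) that by (metis add_0 diff_zero length_upt nth_map nth_upt)
  have len: "length p + (length u + length s) = l"
    using arg_cong[OF pw, of length] us(1) by simp
  have "walk B (p @ u @ map Inl s)"
    using walk_of_path[OF x(1), of l] pw us by simp
  then have walk: "walk B (p @ u)" using walk_append[of B "p @ u"] by simp
  have "x k \<in> Inl ` edges C k" if k: "length (p @ u) \<le> k" for k
  proof (cases "k < l")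
    case True
    then have "x k = ((p @ u) @ map Inl s) ! k" using nth by simp
    also have "\<dots> = Inl (s ! (k - length (p @ u)))"
      using k True len by (subst nth_append) simp
    finally have "x k = Inl (s ! (k - length (p @ u)))" .
    moreover have "x k \<in> edges B k" using x by (simp add: path_space_def)
    ultimately show ?thesis by (auto simp: Inl_edge_iff)
  next
    case False
    then show ?thesis using m by (simp add: l_def)
  qed
  moreover have "x i = (p @ u) ! i" if i: "i < length (p @ u)" for i
  proof -
    have "x i = ((p @ u) @ map Inl s) ! i" using nth i len by simp
    also have "\<dots> = (p @ u) ! i" using i by (subst nth_append) simp
    finally show ?thesis .
  qed
  ultimately have "x \<in> tail_cylinder (p @ u)"
    using x(1) by (auto simp: tail_cylinder_def cylinder_def)
  then show "x \<in> (\<Union>u\<in>?U. tail_cylinder (p @ u))" using walk us(2) by blast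
next
  fix x assume "x \<in> (\<Union>u\<in>?U. tail_cylinder (p @ u))"
  then obtain u where "x \<in> tail_cylinder (p @ u)" by blast
  moreover from this have "x i = p ! i" if "i < length p" for i
    using that by (simp add: tail_cylinder_def cylinder_def nth_append)
  ultimately show "x \<in> cylinder B p \<inter> saturation C B"
    using tail_cylinder_subset_saturation tail_cylinder_subset_path_space
    by (fastforce simp: cylinder_def)
qed

section \<open>Measurability of the saturation and of the transport\<close>

lemma sets_saturation: "saturation C B \<in> sets (path_borel B)"
proof -
  have "saturation C B =
      (\<Union>m. \<Inter>k\<in>{m..}. {x \<in> path_space B. x k \<in> Inl ` edges C k})"
    by (auto simp: saturation_eq)
  also have "\<dots> \<in> sets (path_borel B)"
    by (intro sets.countable_UN' sets.countable_INT' sets_path_coordinate[OF diagram_B]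
        image_subsetI) auto
  finally show ?thesis .
qed

lemma sets_tail_cylinder:
  assumes "walk B r"
  shows "tail_cylinder r \<in> sets (path_borel B)"
proof -
  have "tail_cylinder r = cylinder B r \<inter>
      (\<Inter>k\<in>{length r..}. {x \<in> path_space B. x k \<in> Inl ` edges C k})"
    by (auto simp: tail_cylinder_def cylinder_def)
  also have "\<dots> \<in> sets (path_borel B)"
    by (intro sets.Int sets_cylinder assms sets.countable_INT'
        sets_path_coordinate[OF diagram_B] image_subsetI) auto
  finally show ?thesis .
qed

text \<open>The part of \<open>A\<close> inside the tail cylinder of \<open>r\<close>, seen in the
  path space of \<open>C\<close>, where \<open>M\<close> can measure it.\<close>

definition pullback :: "('e + 'f) list \<Rightarrow> (nat \<Rightarrow> 'e + 'f) set \<Rightarrow> (nat \<Rightarrow> 'e) set" where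
  "pullback r A = {y \<in> cylinder C (companion r). transfer r y \<in> A}"

lemma sets_pullback:
  assumes r: "walk B r" and A: "A \<in> sets (path_borel B)"
  shows "pullback r A \<in> sets M"
proof -
  let ?c = "cylinder C (companion r)"
  let ?R = "restrict_space (path_borel C) ?c"
  have c: "?c \<in> sets (path_borel C)" by (intro sets_cylinder walk_companion r)
  have space: "space ?R = ?c"
    using cylinder_subset_path_space by (auto simp: space_restrict_space space_path_borel)
  have "transfer r \<in> measurable ?R (path_borel B)"
  proof (rule measurable_path_borelI[OF diagram_B])
    show "transfer r \<in> space ?R \<rightarrow> path_space B"
    proof
      fix y assume "y \<in> space ?R"
      then have "transfer r y \<in> tail_cylinder r"
        unfolding space by (rule transfer_mem_tail_cylinder[OF r same_end_companion[OF r]])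
      then show "transfer r y \<in> path_space B" by (simp add: tail_cylinder_def cylinder_def)
    qed
    fix n e
    have "{y \<in> space ?R. transfer r y n = e}
        = ?c \<inter> {y \<in> path_space C. (if n < length r then r ! n else Inl (y n)) = e}"
      using cylinder_subset_path_space
      by (auto simp: space graft_def embed_path_def)
    also have "\<dots> \<in> sets ?R"
      using sets_path_coordinate[OF diagram_C,
          of "\<lambda>a. (if n < length r then r ! n else Inl a) = e" n]
      by (auto simp: sets_restrict_space)
    finally show "{y \<in> space ?R. transfer r y n = e} \<in> sets ?R" .
  qed
  from measurable_sets[OF this A] have "pullback r A \<in> sets ?R"
    by (simp add: pullback_def space vimage_def Int_def conj_commute)
  then show ?thesis
    using c by (simp add: sets_M sets_restrict_space_iff sets.Int_space_eq2)
qed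

text \<open>Forward images are measurable here because the image is a preimage under the inverse of
  the transfer, which is measurable on the tail cylinder.\<close>

lemma sets_transfer_image:
  assumes r: "walk B r" and S: "S \<in> sets M" "S \<subseteq> cylinder C (companion r)"
  shows "transfer r ` S \<in> sets (path_borel B)"
proof -
  let ?R = "restrict_space (path_borel B) (tail_cylinder r)"
  let ?g = "\<lambda>x. graft (companion r) (\<lambda>k. projl (x k))"
  note q = companion[OF r]
  have len: "length (companion r) = length r" using q by (simp add: same_end_def)
  have space: "space ?R = tail_cylinder r"
    using tail_cylinder_subset_path_space by (auto simp: space_restrict_space space_path_borel)
  have "?g \<in> measurable ?R (path_borel C)"
  proof (rule measurable_path_borelI[OF diagram_C])
    show "?g \<in> space ?R \<rightarrow> path_space C"
      using untransfer_mem[OF q] cylinder_subset_path_space unfolding space by blast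
    fix n e
    have "{x \<in> space ?R. ?g x n = e}
        = tail_cylinder r \<inter>
          {x \<in> path_space B. (if n < length r then companion r ! n else projl (x n)) = e}"
      using tail_cylinder_subset_path_space[of r] by (auto simp: space graft_def len)
    also have "\<dots> \<in> sets ?R"
      using sets_path_coordinate[OF diagram_B,
          of "\<lambda>a. (if n < length r then companion r ! n else projl a) = e" n]
      by (auto simp: sets_restrict_space)
    finally show "{x \<in> space ?R. ?g x n = e} \<in> sets ?R" .
  qed
  from measurable_sets[OF this, of S] S have "?g -` S \<inter> tail_cylinder r \<in> sets ?R"
    by (simp add: space sets_M)
  then have *: "?g -` S \<inter> tail_cylinder r \<in> sets (path_borel B)"
    using sets_tail_cylinder[OF r] by (simp add: sets_restrict_space_iff sets.Int_space_eq2)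
  have "transfer r ` S = ?g -` S \<inter> tail_cylinder r"
  proof (intro equalityI subsetI)
    fix x assume "x \<in> transfer r ` S"
    then obtain y where y: "y \<in> S" "x = transfer r y" by blast
    then have x: "x \<in> tail_cylinder r"
      using transfer_mem_tail_cylinder[OF r q(2)] S(2) by blast
    have "transfer r (?g x) = transfer r y"
      using transfer_untransfer[OF q x] y by simp
    then have "?g x = y"
      using inj_on_transfer[OF len] untransfer_mem[OF q x] y S(2)
      by (auto dest!: inj_onD)
    then show "x \<in> ?g -` S \<inter> tail_cylinder r" using x y by simp
  next
    fix x assume x: "x \<in> ?g -` S \<inter> tail_cylinder r"
    then have "x = transfer r (?g x)" using transfer_untransfer[OF q] by simp
    then show "x \<in> transfer r ` S" using x by blast
  qed
  with * show ?thesis by simp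
qed

section \<open>The measure and its values on tail cylinders\<close>

text \<open>Writing the sum over the exits as an integral against counting measure turns countable
  additivity into an exchange of sum and integral.\<close>

definition extended_measure :: "(nat \<Rightarrow> 'e + 'f) measure" where
  "extended_measure = measure_of (path_space B) (sets (path_borel B))
     (\<lambda>A. \<integral>\<^sup>+ r. emeasure M (pullback r A) \<partial>count_space exits)"

lemma space_extended_measure: "space extended_measure = path_space B"
  by (simp add: extended_measure_def space_measure_of_conv)

lemma sets_extended_measure: "sets extended_measure = sets (path_borel B)"
  unfolding extended_measure_def
  by (metis sets.sets_measure_of_eq space_path_borel)

lemma walk_exits: "r \<in> exits \<Longrightarrow> walk B r"
  by (simp add: exits_def)

lemma emeasure_extended:
  assumes "A \<in> sets (path_borel B)"
  shows "emeasure extended_measure A = (\<integral>\<^sup>+ r. emeasure M (pullback r A) \<partial>count_space exits)"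
  unfolding extended_measure_def
proof (rule emeasure_measure_of_sigma)
  show "sigma_algebra (path_space B) (sets (path_borel B))"
    by (metis sets.sigma_algebra_axioms space_path_borel)
  show "positive (sets (path_borel B))
      (\<lambda>A. \<integral>\<^sup>+ r. emeasure M (pullback r A) \<partial>count_space exits)"
    by (simp add: positive_def pullback_def)
  show "countably_additive (sets (path_borel B))
      (\<lambda>A. \<integral>\<^sup>+ r. emeasure M (pullback r A) \<partial>count_space exits)"
  proof (rule countably_additiveI)
    fix A :: "nat \<Rightarrow> (nat \<Rightarrow> 'e + 'f) set"
    assume A: "range A \<subseteq> sets (path_borel B)" "disjoint_family A"
    have "(\<Sum>i. \<integral>\<^sup>+ r. emeasure M (pullback r (A i)) \<partial>count_space exits)
        = (\<integral>\<^sup>+ r. (\<Sum>i. emeasure M (pullback r (A i))) \<partial>count_space exits)"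
      by (rule nn_integral_suminf[symmetric]) simp
    also have "\<dots> = (\<integral>\<^sup>+ r. emeasure M (pullback r (\<Union>i. A i)) \<partial>count_space exits)"
    proof (rule nn_integral_cong)
      fix r assume "r \<in> space (count_space exits)"
      then have r: "walk B r" by (simp add: walk_exits)
      have "disjoint_family (\<lambda>i. pullback r (A i))"
        using A(2) by (auto simp: disjoint_family_on_def pullback_def)
      moreover have "range (\<lambda>i. pullback r (A i)) \<subseteq> sets M"
        using A(1) sets_pullback[OF r] by auto
      ultimately have "(\<Sum>i. emeasure M (pullback r (A i))) = emeasure M (\<Union>i. pullback r (A i))"
        by (rule suminf_emeasure[rotated])
      also have "(\<Union>i. pullback r (A i)) = pullback r (\<Union>i. A i)"
        by (auto simp: pullback_def)
      finally show "(\<Sum>i. emeasure M (pullback r (A i))) = emeasure M (pullback r (\<Union>i. A i))" .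
    qed
    finally show "(\<Sum>i. \<integral>\<^sup>+ r. emeasure M (pullback r (A i)) \<partial>count_space exits)
        = (\<integral>\<^sup>+ r. emeasure M (pullback r (\<Union>i. A i)) \<partial>count_space exits)" .
  qed
qed (fact assms)

lemma transfer_exit_mem:
  assumes "r \<in> exits" "y \<in> cylinder C (companion r)"
  shows "transfer r y \<in> tail_cylinder r"
  using assms transfer_mem_tail_cylinder same_end_companion walk_exits by blast

lemma exits_unique:
  assumes "r \<in> exits" "r' \<in> exits" "x \<in> tail_cylinder r" "x \<in> tail_cylinder r'"
  shows "r = r'"
  using tail_cylinder_disjoint[of r r' x "[]"] assms by (simp add: exits_def)

text \<open>Tail cylinders of distinct exits are disjoint, so a single summand survives.\<close>

lemma emeasure_extended_exit:
  assumes A: "A \<in> sets (path_borel B)" and r: "r \<in> exits" and sub: "A \<subseteq> tail_cylinder r"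
  shows "emeasure extended_measure A = emeasure M (pullback r A)"
proof -
  have "pullback r' A = {}" if "r' \<in> exits" "r' \<noteq> r" for r'
    using that exits_unique[OF _ r] transfer_exit_mem sub by (fastforce simp: pullback_def)
  then have "emeasure extended_measure A
      = (\<integral>\<^sup>+ r'. emeasure M (pullback r A) * indicator {r} r' \<partial>count_space exits)"
    unfolding emeasure_extended[OF A] by (intro nn_integral_cong) (auto split: split_indicator)
  also have "\<dots> = emeasure M (pullback r A)"
    using r by (subst nn_integral_cmult_indicator) auto
  finally show ?thesis .
qed

lemma emeasure_extended_ge:
  assumes A: "A \<in> sets (path_borel B)" and r: "r \<in> exits"
  shows "emeasure M (pullback r A) \<le> emeasure extended_measure A"
proof -
  have A': "A \<inter> tail_cylinder r \<in> sets (path_borel B)"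
    using A sets_tail_cylinder[OF walk_exits[OF r]] by blast
  have "pullback r A = pullback r (A \<inter> tail_cylinder r)"
    using transfer_exit_mem[OF r] by (auto simp: pullback_def)
  then have "emeasure M (pullback r A) = emeasure extended_measure (A \<inter> tail_cylinder r)"
    using emeasure_extended_exit[OF A' r] by simp
  also have "\<dots> \<le> emeasure extended_measure A"
    using A by (intro emeasure_mono) (auto simp: sets_extended_measure)
  finally show ?thesis .
qed

text \<open>Cut \<open>p\<close> after its last added edge into an exit \<open>r\<close> and
  original edges \<open>s\<close>. Its tail cylinder lies in that of \<open>r\<close>, and its
  pullback is the cylinder of \<open>companion r @ s\<close>. This walk of \<open>C\<close> ends
  where \<open>p\<close> and \<open>q\<close> end, so tail invariance of \<open>M\<close>
  finishes.\<close>

lemma emeasure_tail_cylinder: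
  assumes p: "walk B p" and q: "walk C q" "same_end B p C q"
  shows "emeasure extended_measure (tail_cylinder p) = emeasure M (cylinder C q)"
proof -
  obtain r s where p_eq: "p = r @ map Inl s" and r_last: "r \<noteq> [] \<longrightarrow> last r \<in> range Inr"
    using split_last_Inr by blast
  have r: "r \<in> exits" using p r_last unfolding p_eq exits_def by (simp add: walk_append)
  let ?q = "companion r"
  note q' = companion[OF walk_exits[OF r]]
  have len: "length ?q = length r" using q'(2) by (simp add: same_end_def)
  have s_edge: "s ! i \<in> edges C (length r + i)" if "i < length s" for i
    using p that unfolding p_eq walk_append by (auto simp: Inl_edge_iff)
  have s_step: "rng C (length r + i) (s ! i) = src C (Suc (length r + i)) (s ! Suc i)"
    if "Suc i < length s" for i
    using p that s_edge[of i] s_edge[of "Suc i"] unfolding p_eq walk_append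
    by (auto simp: rng_Inl src_Inl)
  have s_join: "rng C (length ?q - 1) (last ?q) = src C (length ?q) (hd s)"
    if "?q \<noteq> []" "s \<noteq> []"
  proof -
    have "r \<noteq> []" using that len by auto
    then show ?thesis
      using p that s_edge[of 0] q'(2) len unfolding p_eq walk_append
      by (auto simp: src_Inl hd_map hd_conv_nth same_end_def)
  qed
  have walk: "walk C (?q @ s)"
    using q'(1) s_edge s_step s_join len by (auto simp: walk_append)
  have "same_end B p C (?q @ s)"
  proof (cases s rule: rev_cases)
    case Nil
    then show ?thesis using q'(2) p_eq by simp
  next
    case (snoc s' e)
    then show ?thesis
      using s_edge[of "length s'"] len by (auto simp: p_eq same_end_def rng_Inl)
  qed
  then have end_q: "same_end C (?q @ s) C q"
    using q(2) same_end_sym same_end_trans by blast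
  have sub: "tail_cylinder p \<subseteq> tail_cylinder r"
  proof
    fix x assume x: "x \<in> tail_cylinder p"
    have "x k \<in> Inl ` edges C k" if k: "length r \<le> k" for k
    proof (cases "k < length p")
      case True
      then have "x k = Inl (s ! (k - length r))"
        using x k by (simp add: tail_cylinder_def cylinder_def p_eq nth_append)
      then show ?thesis using s_edge[of "k - length r"] k True by (simp add: p_eq)
    next
      case False
      then show ?thesis using x by (simp add: tail_cylinder_def)
    qed
    then show "x \<in> tail_cylinder r"
      using x by (auto simp: tail_cylinder_def cylinder_def p_eq nth_append)
  qed
  have "pullback r (tail_cylinder p) = cylinder C (?q @ s)"
  proof (intro equalityI subsetI)
    fix y assume y: "y \<in> pullback r (tail_cylinder p)"
    have "y i = (?q @ s) ! i" if i: "i < length (?q @ s)" for i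
    proof (cases "i < length r")
      case True
      then show ?thesis using y len by (simp add: pullback_def cylinder_def nth_append)
    next
      case False
      have "transfer r y i = p ! i"
        using y i len by (simp add: pullback_def tail_cylinder_def cylinder_def p_eq)
      then show ?thesis
        using False i len by (simp add: graft_def embed_path_def p_eq nth_append)
    qed
    then show "y \<in> cylinder C (?q @ s)"
      using y by (auto simp: pullback_def cylinder_def)
  next
    fix y assume y: "y \<in> cylinder C (?q @ s)"
    have nth: "y i = (?q @ s) ! i" if "i < length ?q + length s" for i
      using y that by (simp add: cylinder_def)
    have yq: "y \<in> cylinder C ?q"
      using y nth by (simp add: cylinder_def nth_append)
    then have t: "transfer r y \<in> tail_cylinder r" by (rule transfer_exit_mem[OF r])
    have "transfer r y i = p ! i" if "i < length p" for i
      using nth[of i] that len by (simp add: graft_def embed_path_def p_eq nth_append)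
    then have "transfer r y \<in> tail_cylinder p"
      using t by (auto simp: tail_cylinder_def cylinder_def p_eq)
    then show "y \<in> pullback r (tail_cylinder p)" using yq by (simp add: pullback_def)
  qed
  then show ?thesis
    using emeasure_extended_exit[OF sets_tail_cylinder[OF p] r sub]
      emeasure_cylinder_same_end[OF walk q(1) end_q] by simp
qed

lemma emeasure_extended_saturation_compl:
  "emeasure extended_measure (path_space B - saturation C B) = 0"
proof -
  have A: "path_space B - saturation C B \<in> sets (path_borel B)"
    using sets_saturation sets.compl_sets[of "saturation C B" "path_borel B"]
    by (simp add: space_path_borel)
  have "pullback r (path_space B - saturation C B) = {}" if "r \<in> exits" for r
    using transfer_exit_mem[OF that] tail_cylinder_subset_saturation
    by (auto simp: pullback_def)
  then show ?thesis
    unfolding emeasure_extended[OF A]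
    by (subst nn_integral_0_iff_AE) (auto simp: AE_count_space)
qed

lemma emeasure_extended_Int_saturation:
  assumes "A \<in> sets (path_borel B)"
  shows "emeasure extended_measure A = emeasure extended_measure (A \<inter> saturation C B)"
proof (rule emeasure_eq_AE)
  show "AE x in extended_measure. x \<in> A \<longleftrightarrow> x \<in> A \<inter> saturation C B"
  proof (rule AE_I)
    show "emeasure extended_measure (path_space B - saturation C B) = 0"
      by (rule emeasure_extended_saturation_compl)
    show "path_space B - saturation C B \<in> sets extended_measure"
      using sets_saturation sets.compl_sets[of "saturation C B" "path_borel B"]
      by (simp add: space_path_borel sets_extended_measure)
  qed (auto simp: space_extended_measure)
qed (use assms sets_saturation in \<open>auto simp: sets_extended_measure\<close>)

section \<open>Tail invariance and absence of atoms\<close>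

lemma emeasure_extended_cylinder:
  assumes p: "walk B p"
  shows "emeasure extended_measure (cylinder B p) =
    (\<integral>\<^sup>+ u. emeasure extended_measure (tail_cylinder (p @ u))
       \<partial>count_space {u. walk B (p @ u) \<and> (u \<noteq> [] \<longrightarrow> last u \<in> range Inr)})"
    (is "_ = (\<integral>\<^sup>+ u. _ \<partial>count_space ?U)")
proof -
  have "countable ((@) p ` ?U)"
    by (rule countable_subset[OF _ countable_walks[OF diagram_B]]) auto
  then have "countable ?U" by (rule countable_image_inj_on) (auto intro: inj_onI)
  moreover have "disjoint_family_on (\<lambda>u. tail_cylinder (p @ u)) ?U"
    unfolding disjoint_family_on_def
  proof (intro ballI impI equals0I)
    fix u v x
    assume "u \<in> ?U" "v \<in> ?U" "u \<noteq> v" "x \<in> tail_cylinder (p @ u) \<inter> tail_cylinder (p @ v)"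
    then show False using tail_cylinder_disjoint[of u v x p] by simp
  qed
  moreover have "tail_cylinder (p @ u) \<in> sets extended_measure" if "u \<in> ?U" for u
    using that by (simp add: sets_extended_measure sets_tail_cylinder)
  ultimately show ?thesis
    unfolding emeasure_extended_Int_saturation[OF sets_cylinder[OF p]]
      cylinder_Int_saturation[OF p]
    by (intro emeasure_UN_countable) auto
qed

text \<open>Both cylinders decompose over the same continuations \<open>u\<close>, and
  \<open>p @ u\<close> and \<open>q @ u\<close> again have a common end, so the decompositions agree
  piece by piece.\<close>

lemma emeasure_extended_cylinder_same_end:
  assumes p: "walk B p" and q: "walk B q" and pq: "same_end B p B q"
  shows "emeasure extended_measure (cylinder B p) = emeasure extended_measure (cylinder B q)"
proof -
  have "{u. walk B (p @ u) \<and> (u \<noteq> [] \<longrightarrow> last u \<in> range Inr)} =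
      {u. walk B (q @ u) \<and> (u \<noteq> [] \<longrightarrow> last u \<in> range Inr)}"
    using walk_append_same_end[OF assms] by simp
  moreover have "emeasure extended_measure (tail_cylinder (p @ u)) =
      emeasure extended_measure (tail_cylinder (q @ u))" if u: "walk B (q @ u)" for u
  proof -
    have pu: "walk B (p @ u)" using walk_append_same_end[OF assms] u by simp
    have "same_end B (p @ u) C (companion (q @ u))"
      using same_end_trans[OF same_end_append[OF pq] same_end_companion[OF u]] .
    then show ?thesis
      using emeasure_tail_cylinder[OF pu walk_companion[OF u]]
        emeasure_tail_cylinder[OF u companion[OF u]] by simp
  qed
  ultimately show ?thesis
    unfolding emeasure_extended_cylinder[OF p] emeasure_extended_cylinder[OF q]
    by (auto intro!: nn_integral_cong)
qed

lemma pullback_transfer_image: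
  assumes r: "walk B r" and S: "S \<subseteq> cylinder C (companion r)"
  shows "pullback r (transfer r ` S) = S"
proof -
  have "length (companion r) = length r"
    using same_end_companion[OF r] by (simp add: same_end_def)
  from inj_on_transfer[OF this] show ?thesis
    using S by (auto simp: pullback_def dest: inj_onD)
qed

text \<open>A set of positive mass has a pullback of positive mass for some exit. \<open>M\<close>
  splits this pullback into two parts of positive mass, and the transfer of one of them splits the
  given set.\<close>

lemma non_atomic_extended: "non_atomic extended_measure"
  unfolding non_atomic_def
proof
  assume "\<exists>A. measure_atom extended_measure A"
  then obtain A where A: "A \<in> sets (path_borel B)" and pos: "emeasure extended_measure A > 0"
    and atom: "\<And>S. S \<in> sets (path_borel B) \<Longrightarrow> S \<subseteq> A \<Longrightarrow>
        emeasure extended_measure S = 0 \<or> emeasure extended_measure (A - S) = 0"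
    unfolding measure_atom_def sets_extended_measure by blast
  have "\<exists>r\<in>exits. emeasure M (pullback r A) > 0"
  proof (rule ccontr)
    assume "\<not> (\<exists>r\<in>exits. emeasure M (pullback r A) > 0)"
    then have "emeasure extended_measure A = 0"
      unfolding emeasure_extended[OF A]
      by (subst nn_integral_0_iff_AE) (auto simp: AE_count_space)
    with pos show False by simp
  qed
  then obtain r where r: "r \<in> exits" and pos_r: "emeasure M (pullback r A) > 0" by blast
  note w = walk_exits[OF r]
  have "\<not> measure_atom M (pullback r A)"
    using non_atomic_M by (simp add: non_atomic_def)
  then obtain S where S: "S \<in> sets M" "S \<subseteq> pullback r A"
    and S_pos: "emeasure M S \<noteq> 0" "emeasure M (pullback r A - S) \<noteq> 0"
    using sets_pullback[OF w A] pos_r unfolding measure_atom_def by blast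
  have S_cyl: "S \<subseteq> cylinder C (companion r)" using S(2) by (auto simp: pullback_def)
  let ?S = "transfer r ` S"
  have S': "?S \<in> sets (path_borel B)" by (rule sets_transfer_image[OF w S(1) S_cyl])
  have eq: "pullback r ?S = S" by (rule pullback_transfer_image[OF w S_cyl])
  moreover have "pullback r (A - ?S) = pullback r A - pullback r ?S"
    by (auto simp: pullback_def)
  ultimately have "emeasure extended_measure ?S \<noteq> 0" "emeasure extended_measure (A - ?S) \<noteq> 0"
    using emeasure_extended_ge[OF S' r] emeasure_extended_ge[OF sets.Diff[OF A S'] r] S_pos
    by auto
  moreover have "?S \<subseteq> A" using S(2) by (auto simp: pullback_def)
  ultimately show False using atom[OF S'] by blast
qed

lemma measure_extension_extended: "measure_extension C M B extended_measure"
  unfolding measure_extension_def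
proof (intro conjI ballI allI impI)
  show "tail_invariant_measure B extended_measure"
    unfolding tail_invariant_measure_def
    using space_extended_measure sets_extended_measure non_atomic_extended
      emeasure_extended_cylinder_same_end same_end_iff_path_end finite_path_iff_walk
    by metis
next
  fix A assume A: "A \<in> sets M"
  \<comment> \<open>Over the empty exit the transfer is \<open>embed_path\<close> and the companion
    cylinder is the whole path space of \<open>C\<close>.\<close>
  have exit: "[] \<in> exits" by (simp add: exits_def walk_Nil)
  have A_cyl: "A \<subseteq> cylinder C (companion [])"
    using sets.sets_into_space[OF A] by (simp add: companion_Nil cylinder_Nil space_M)
  have img: "embed_path ` A = transfer [] ` A" by (simp add: graft_Nil)
  have sets: "embed_path ` A \<in> sets (path_borel B)"
    unfolding img by (rule sets_transfer_image[OF walk_Nil A A_cyl])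
  then show "embed_path ` A \<in> sets extended_measure" by (simp add: sets_extended_measure)
  have "embed_path ` A \<subseteq> tail_cylinder []"
    unfolding img using transfer_exit_mem[OF exit] A_cyl by blast
  from emeasure_extended_exit[OF sets exit this]
  show "emeasure extended_measure (embed_path ` A) = emeasure M A"
    unfolding img pullback_transfer_image[OF walk_Nil A_cyl] .
next
  show "saturation C B \<in> sets extended_measure"
    by (simp add: sets_extended_measure sets_saturation)
  show "emeasure extended_measure (path_space B - saturation C B) = 0"
    by (rule emeasure_extended_saturation_compl)
next
  fix p q assume "finite_path B p \<and> finite_path C q \<and> path_end B p = path_end C q"
  then show "emeasure extended_measure {x \<in> cylinder B p. \<forall>k\<ge>length p. x k \<in> Inl ` edges C k}
      = emeasure M (cylinder C q)"
    using emeasure_tail_cylinder[of p q]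
    by (auto simp: finite_path_iff_walk same_end_iff_path_end tail_cylinder_def)
qed

end

subsection \<open>Edges escaping to infinity\<close>

text \<open>The in-degree of \<open>v\<close> is the row sum of the incidence matrix, since all
  sources lie in the window.\<close>

lemma card_edges_into_bounded_size:
  assumes "bounded_size C t L"
  shows "finite (edges_into C n v)" "card (edges_into C n v) \<le> L n"
proof -
  let ?W = "{v - int (t n)..v + int (t n)}"
  let ?E = "\<lambda>w. {e \<in> edges C n. src C n e = w \<and> rng C n e = v}"
  have "generalized_bratteli_diagram C" "v \<in> verts C (Suc n)"
    using assms by (auto simp: bounded_size_def)
  then show fin: "finite (edges_into C n v)" by (simp add: generalized_bratteli_diagram_def)
  have "edges_into C n v = (\<Union>w\<in>?W. ?E w)"
    using assms unfolding bounded_size_def edges_into_def by blast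
  moreover have "card (\<Union>w\<in>?W. ?E w) = (\<Sum>w\<in>?W. card (?E w))"
    by (rule card_UN_disjoint) (auto intro: finite_subset[OF _ fin] simp: edges_into_def)
  moreover have "(\<Sum>w\<in>?W. card (?E w)) \<le> L n"
    using assms by (simp add: bounded_size_def incidence_def)
  ultimately show "card (edges_into C n v) \<le> L n" by simp
qed

text \<open>Induction on the last edge. At length 0 the set is \<open>{[]}\<close> for every
  \<open>v\<close>, which matches the empty product.\<close>

lemma card_walks_to:
  fixes B :: "('v, 'e) graded_graph"
  assumes fin: "\<And>n v. finite (edges_into B n v)"
    and card: "\<And>n v. card (edges_into B n v) \<le> D n"
  shows "finite {p. walk B p \<and> length p = n \<and> (p \<noteq> [] \<longrightarrow> rng B (n - 1) (last p) = v)} \<and>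
    card {p. walk B p \<and> length p = n \<and> (p \<noteq> [] \<longrightarrow> rng B (n - 1) (last p) = v)}
      \<le> (\<Prod>i<n. D i)" (is "finite (?W n v) \<and> card (?W n v) \<le> _")
proof (induction n arbitrary: v)
  case 0
  have "?W 0 v = {[]}" by (auto simp: walk_Nil)
  then show ?case by simp
next
  case (Suc n)
  let ?f = "\<lambda>e. (\<lambda>p. p @ [e]) ` ?W n (src B n e)"
  have sub: "?W (Suc n) v \<subseteq> (\<Union>e\<in>edges_into B n v. ?f e)"
  proof
    fix p assume p: "p \<in> ?W (Suc n) v"
    then obtain p' e where "p = p' @ [e]" by (cases p rule: rev_cases) auto
    then show "p \<in> (\<Union>e\<in>edges_into B n v. ?f e)"
      using p by (auto simp: walk_snoc edges_into_def)
  qed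
  have finU: "finite (\<Union>e\<in>edges_into B n v. ?f e)"
    using Suc.IH fin by blast
  have "card (?W (Suc n) v) \<le> card (\<Union>e\<in>edges_into B n v. ?f e)"
    by (rule card_mono[OF finU sub])
  also have "\<dots> \<le> (\<Sum>e\<in>edges_into B n v. card (?f e))"
    by (rule card_UN_le[OF fin])
  also have "\<dots> \<le> (\<Sum>e\<in>edges_into B n v. \<Prod>i<n. D i)"
    using Suc.IH by (intro sum_mono) (blast intro: order_trans[OF card_image_le])
  also have "\<dots> \<le> (\<Prod>i<Suc n. D i)"
    using card[of n v] by (simp add: mult.commute)
  finally show ?case using finite_subset[OF sub finU] by blast
qed

lemma (in finite_measure) tail_sum_emeasure_small:
  assumes A: "range A \<subseteq> sets M" "disjoint_family A" and "(\<epsilon>::real) > 0"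
  obtains k where "(\<Sum>i. emeasure M (A (k + i))) \<le> ennreal \<epsilon>"
proof -
  have "summable (\<lambda>i. measure M (A i))"
    using finite_measure_UNION[OF A] by (rule sums_summable)
  from suminf_exist_split[OF \<open>\<epsilon> > 0\<close> this] obtain k where
    k: "norm (\<Sum>i. measure M (A (i + k))) < \<epsilon>" by blast
  have "(\<Sum>i. emeasure M (A (k + i))) = ennreal (\<Sum>i. measure M (A (i + k)))"
    using summable_ignore_initial_segment[OF \<open>summable _\<close>, of k]
    by (simp add: emeasure_eq_measure add.commute[of k] suminf_ennreal2)
  also have "\<dots> \<le> ennreal \<epsilon>" using k by (intro ennreal_leI) simp
  finally show ?thesis using that by blast
qed

text \<open>The added edge \<open>Inr a\<close> is determined by its level and target, so each
  vertex gains at most one incoming edge per level; only the out-degree of 0 becomes infinite, which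
  a generalized Bratteli diagram permits.\<close>

definition escape_extension ::
    "(int, 'e) graded_graph \<Rightarrow> (nat \<Rightarrow> nat) \<Rightarrow> (int, 'e + nat) graded_graph" where
  "escape_extension C K =
     \<lparr>verts = \<lambda>_. UNIV,
      edges = \<lambda>n. Inl ` edges C n \<union> range Inr,
      src = \<lambda>n. case_sum (src C n) (\<lambda>_. 0),
      rng = \<lambda>n. case_sum (rng C n) (\<lambda>a. int (K n + a))\<rparr>"

text \<open>Only an inclusion: for \<open>v\<close> below \<open>K n\<close> no added edge ends at
  \<open>v\<close>, and the truncated index names an edge that ends elsewhere.\<close>

lemma edges_into_escape_extension:
  "edges_into (escape_extension C K) n v \<subseteq>
     insert (Inr (nat v - K n)) (Inl ` edges_into C n v)"
  by (auto simp: escape_extension_def edges_into_def)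

lemma edge_extension_escape:
  assumes C: "generalized_bratteli_diagram C" and UNIV: "\<And>n. verts C n = UNIV"
  shows "edge_extension C (escape_extension C K)" (is "edge_extension C ?B")
proof -
  have "generalized_bratteli_diagram ?B"
    unfolding generalized_bratteli_diagram_def
  proof (intro conjI allI ballI)
    fix n v
    show "countable (verts ?B n)" "infinite (verts ?B n)"
      by (simp_all add: escape_extension_def infinite_UNIV_int)
    show "countable (edges ?B n)"
      using C by (simp add: escape_extension_def generalized_bratteli_diagram_def)
    have "\<exists>e\<in>edges C n. src C n e = v"
      using C UNIV[of n] unfolding generalized_bratteli_diagram_def by blast
    then show "{e \<in> edges ?B n. src ?B n e = v} \<noteq> {}"
      by (auto simp: escape_extension_def)
    have "finite (edges_into C n v)" "edges_into C n v \<noteq> {}"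
      using C UNIV[of "Suc n"] unfolding generalized_bratteli_diagram_def by blast+
    moreover from this have "finite (insert (Inr (nat v - K n)) (Inl ` edges_into C n v))"
      by blast
    ultimately show "edges_into ?B n v \<noteq> {}" "finite (edges_into ?B n v)"
      using finite_subset[OF edges_into_escape_extension[of C K n v]]
      by (auto simp: escape_extension_def edges_into_def[of _ n v])
  qed (auto simp: escape_extension_def)
  then show ?thesis
    using C UNIV by (auto simp: edge_extension_def escape_extension_def added_edges_def)
qed

section \<open>Choice of the thresholds and bound on the total mass\<close>

theorem theorem3p18:
  fixes C :: "(int, 'e) graded_graph"
    and t L :: "nat \<Rightarrow> nat"
    and M :: "(nat \<Rightarrow> 'e) measure"
  assumes "bounded_size C t L"
    and "tail_invariant_measure C M"
    and "prob_space M"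
  shows "\<exists>(B :: (int, 'e + nat) graded_graph) N.
           edge_extension C B \<and>
           (\<forall>n. countable (added_edges B n) \<and> infinite (added_edges B n)) \<and>
           measure_extension C M B N \<and>
           finite_measure N"
proof -
  interpret M: prob_space M by fact
  have C: "generalized_bratteli_diagram C" and C_UNIV: "\<And>n. verts C n = UNIV"
    using assms(1) by (auto simp: bounded_size_def)
  have sets_M: "sets M = sets (path_borel C)" and space_M: "space M = path_space C"
    using assms(2) by (auto simp: tail_invariant_measure_def)
  have "\<forall>n v. \<exists>p. walk C p \<and> length p = Suc n \<and> rng C n (last p) = int v"
    using ex_walk_to[OF C] C_UNIV by blast
  \<comment> \<open>One representative walk for each possible target of an added edge; these targets
    are all nonnegative.\<close>
  then obtain q where q: "\<And>n v. walk C (q n v)" "\<And>n v. length (q n v) = Suc n"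
    "\<And>n v. rng C n (last (q n v)) = int v"
    by metis
  \<comment> \<open>Will bound the number of walks of \<open>B\<close> of length \<open>n\<close> to
    the vertex 0. It is fixed before \<open>K\<close> and may therefore enter the choice of
    \<open>K\<close>.\<close>
  define H where "H n = (\<Prod>i<n. L i + 1)" for n
  have H_pos: "H n > 0" for n by (simp add: H_def)
  \<comment> \<open>The divisor \<open>H n\<close> compensates for the at most \<open>H n\<close>
    walks through which each added edge of level \<open>n\<close> is reached.\<close>
  have "\<exists>k. (\<Sum>i. emeasure M (cylinder C (q n (k + i)))) \<le> ennreal ((1/2) ^ n / real (H n))" for n
  proof -
    have "disjoint_family (\<lambda>v. cylinder C (q n v))"
      unfolding disjoint_family_on_def
    proof (intro ballI impI equals0I)
      fix v w x assume "v \<noteq> w" "x \<in> cylinder C (q n v) \<inter> cylinder C (q n w)"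
      then have "q n v = q n w" using q(2) by (metis IntE mem_cylinder_iff)
      then show False using q(3)[of n v] q(3)[of n w] \<open>v \<noteq> w\<close> by simp
    qed
    moreover have "range (\<lambda>v. cylinder C (q n v)) \<subseteq> sets M"
      using sets_cylinder q(1) by (auto simp: sets_M)
    ultimately show ?thesis
      using M.tail_sum_emeasure_small[of "\<lambda>v. cylinder C (q n v)" "(1/2) ^ n / real (H n)"] H_pos
      by (metis divide_pos_pos of_nat_0_less_iff zero_less_power half_gt_zero zero_less_one)
  qed
  then obtain K where K: "\<And>n. (\<Sum>i. emeasure M (cylinder C (q n (K n + i))))
      \<le> ennreal ((1/2) ^ n / real (H n))"
    by metis
  define B where "B = escape_extension C K"
  have edge_ext: "edge_extension C B" unfolding B_def by (rule edge_extension_escape[OF C C_UNIV])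
  interpret bratteli_measure_extension C B M by unfold_locales (fact edge_ext, fact assms(2))
  let ?N = extended_measure
  have added: "added_edges B n = UNIV" for n
    by (auto simp: added_edges_def B_def escape_extension_def)
  have into_card: "finite (edges_into B n v)" "card (edges_into B n v) \<le> L n + 1" for n v
  proof -
    let ?S = "insert (Inr (nat v - K n)) (Inl ` edges_into C n v)"
    note sub = edges_into_escape_extension[of C K n v, folded B_def]
    note L = card_edges_into_bounded_size[OF assms(1), of n v]
    have fin: "finite ?S" using L by blast
    show "finite (edges_into B n v)" by (rule finite_subset[OF sub fin])
    have "card (edges_into B n v) \<le> card ?S" by (rule card_mono[OF fin sub])
    also have "\<dots> \<le> Suc (card (edges_into C n v))"
      using L(1) by (simp add: card_insert_if card_image)
    also have "\<dots> \<le> L n + 1" using L(2) by simp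
    finally show "card (edges_into B n v) \<le> L n + 1" .
  qed
  define G where "G n = {s. walk B s \<and> length s = n \<and> (s \<noteq> [] \<longrightarrow> rng B (n - 1) (last s) = 0)}"
    for n
  have G: "finite (G n)" "card (G n) \<le> H n" for n
    using card_walks_to[OF into_card, of n 0] by (simp_all add: G_def H_def)
  \<comment> \<open>The condition on \<open>s\<close> does not involve \<open>a\<close>, as all
    added edges start at 0. For \<open>s = []\<close> both sides hold.\<close>
  have walk_G: "walk B (s @ [Inr a]) \<longleftrightarrow> s \<in> G (length s)" for s a
    by (auto simp: walk_snoc G_def B_def escape_extension_def)
  have meas_G: "tail_cylinder (s @ [Inr a]) \<in> sets ?N" if "s \<in> G n" for s a n
    using that walk_G by (auto simp: sets_extended_measure G_def intro!: sets_tail_cylinder)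
  \<comment> \<open>The paths whose last added edge is \<open>Inr a\<close> at level
    \<open>n\<close>.\<close>
  define E where "E n a = (\<Union>s\<in>G n. tail_cylinder (s @ [Inr a]))" for n and a :: nat
  have E: "E n a \<in> sets ?N" for n a
    using G(1) meas_G by (auto simp: E_def)
  have "emeasure ?N (E n a) \<le> of_nat (H n) * emeasure M (cylinder C (q n (K n + a)))" for n a
  proof -
    have "emeasure ?N (E n a) \<le> (\<Sum>s\<in>G n. emeasure ?N (tail_cylinder (s @ [Inr a])))"
      unfolding E_def using G(1) meas_G by (intro emeasure_subadditive_finite) auto
    also have "\<dots> = (\<Sum>s\<in>G n. emeasure M (cylinder C (q n (K n + a))))"
    proof (rule sum.cong[OF refl])
      fix s assume s: "s \<in> G n"
      then have "same_end B (s @ [Inr a]) C (q n (K n + a))"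
        using q(2,3)[of n "K n + a"]
        by (auto simp: same_end_def G_def B_def escape_extension_def)
      then show "emeasure ?N (tail_cylinder (s @ [Inr a])) = emeasure M (cylinder C (q n (K n + a)))"
        using s walk_G by (intro emeasure_tail_cylinder q) (auto simp: G_def)
    qed
    also have "\<dots> \<le> of_nat (H n) * emeasure M (cylinder C (q n (K n + a)))"
      using G(2) by (auto intro!: mult_right_mono)
    finally show ?thesis .
  qed
  then have E_le: "emeasure ?N (\<Union>a. E n a) \<le> ennreal ((1/2) ^ n)" for n
  proof -
    have "emeasure ?N (\<Union>a. E n a) \<le> (\<Sum>a. emeasure ?N (E n a))"
      using E by (intro emeasure_subadditive_countably) auto
    also have "\<dots> \<le> (\<Sum>a. of_nat (H n) * emeasure M (cylinder C (q n (K n + a))))"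
      by (intro suminf_le \<open>\<And>n a. emeasure ?N (E n a) \<le> _\<close>) auto
    also have "\<dots> = of_nat (H n) * (\<Sum>a. emeasure M (cylinder C (q n (K n + a))))"
      by simp
    also have "\<dots> \<le> ennreal (real (H n)) * ennreal ((1/2) ^ n / real (H n))"
      using K[of n] by (auto simp: ennreal_of_nat_eq_real_of_nat intro!: mult_left_mono)
    also have "\<dots> = ennreal ((1/2) ^ n)"
      using H_pos[of n] by (simp flip: ennreal_mult)
    finally show ?thesis .
  qed
  \<comment> \<open>A path of the saturation either has no added edge or is sorted by its last one.
    The first class has mass 1, the classes of level \<open>n\<close> together at most 2^-n.\<close>
  have "saturation C B \<subseteq> tail_cylinder [] \<union> (\<Union>n. \<Union>a. E n a)"
  proof
    fix x assume "x \<in> saturation C B"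
    then have "x \<in> cylinder B [] \<inter> saturation C B"
      by (auto simp: cylinder_Nil saturation_def)
    then obtain u where u: "walk B u" "u \<noteq> [] \<longrightarrow> last u \<in> range Inr" "x \<in> tail_cylinder u"
      unfolding cylinder_Int_saturation[OF walk_Nil] by auto
    show "x \<in> tail_cylinder [] \<union> (\<Union>n. \<Union>a. E n a)"
    proof (cases u rule: rev_cases)
      case Nil
      then show ?thesis using u by simp
    next
      case (snoc s e)
      then obtain a where "u = s @ [Inr a]" using u by auto
      then have "x \<in> E (length s) a" using u walk_G by (auto simp: E_def)
      then show ?thesis by blast
    qed
  qed
  then have "emeasure ?N (saturation C B)
      \<le> emeasure ?N (tail_cylinder [] \<union> (\<Union>n. \<Union>a. E n a))"
    using E by (intro emeasure_mono) (auto simp: sets_extended_measure sets_tail_cylinder walk_Nil)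
  also have "\<dots> \<le> emeasure ?N (tail_cylinder []) + emeasure ?N (\<Union>n. \<Union>a. E n a)"
    using E by (intro emeasure_subadditive)
      (auto simp: sets_extended_measure sets_tail_cylinder walk_Nil)
  also have "emeasure ?N (tail_cylinder []) = 1"
    using emeasure_tail_cylinder[OF walk_Nil walk_Nil same_end_Nil] M.emeasure_space_1
    by (simp add: cylinder_Nil space_M)
  also have "emeasure ?N (\<Union>n. \<Union>a. E n a) \<le> (\<Sum>n. emeasure ?N (\<Union>a. E n a))"
    using E by (intro emeasure_subadditive_countably) auto
  also have "\<dots> \<le> (\<Sum>n. ennreal ((1/2) ^ n))"
    by (intro suminf_le E_le) auto
  also have "\<dots> = ennreal (\<Sum>n. (1/2) ^ n)"
    by (intro suminf_ennreal2) auto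
  finally have "emeasure ?N (saturation C B) \<le> 1 + ennreal (\<Sum>n. (1/2) ^ n)"
    by (simp add: add_left_mono)
  moreover have "emeasure ?N (space ?N) = emeasure ?N (saturation C B)"
    using emeasure_extended_Int_saturation[OF sets.top]
    by (simp add: space_extended_measure space_path_borel saturation_def Int_def)
  ultimately have "emeasure ?N (space ?N) < top"
    by (simp add: le_less_trans[of _ "1 + ennreal _"])
  then have "finite_measure ?N" by (intro finite_measureI) simp
  then show ?thesis
    using edge_ext added measure_extension_extended by (intro exI[of _ B] exI[of _ ?N]) simp
qed

end
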